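(* Let $A$ be a nonempty compact subset of a finite-dimensional linear subspace of $L_1 = L_1[0,1]$, equipped with the subspace metric. Then the magnitude of $A$ satisfies $|A| < \infty$, and $A$ has the one-point property, that is, $\lim_{t \to 0^+} |tA| = 1$.
   Context: $L_1 = L_1[0,1]$ is the real Banach space of (a.e. equivalence classes of) measurable functions $f : [0,1] \to \mathbb{R}$ with finite integral $1$-norm $\int |f|$, with the metric induced by this norm. For a finite metric space $A$, let $Z_A$ be the matrix $(e^{-d(a,b)})_{a,b\in A}$. If $Z_A$ is invertible, the magnitude $|A|$ is the sum of all the entries of $Z_A^{-1}$. A compact metric space $X$ is positive definite if $Z_A$ is positive definite for every finite $A \subseteq X$; its magnitude is then $|X| = \sup\{|A| : A \subseteq X \text{ finite}\} \in [0,\infty]$. For a metric space $X$ and $t>0$, $tX$ denotes $X$ with the rescaled metric $t\,d_X$. (It is known that all subsets of $L_1$ are of negative type, i.e. $tX$ is positive definite for all $t>0$ whenever $X\subseteq L_1$ is compact, so the magnitudes here are defined.) A compact metric space $X$ has the one-point property if $\lim_{t\to 0^+}|tX| = 1$. *)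

theory Defs
  imports "HOL-Analysis.Analysis"
begin

section \<open>The space L1[0,1]\<close>

text \<open>
  Representatives are functions on the whole real line, but they are compared, measured and
  integrated only on [0,1], so their values elsewhere play no role.
\<close>

abbreviation I01 :: "real measure"
  where "I01 \<equiv> lebesgue_on {0..1}"

definition L1_rel :: "(real \<Rightarrow> real) \<Rightarrow> (real \<Rightarrow> real) \<Rightarrow> bool"
  where "L1_rel f g \<longleftrightarrow> integrable I01 f \<and> integrable I01 g \<and> (AE x in I01. f x = g x)"

lemma L1_rel_part_equivp: "part_equivp L1_rel"
proof (rule part_equivpI)
  show "\<exists>f. L1_rel f f"
    by (rule exI[of _ "\<lambda>_. 0"]) (simp add: L1_rel_def)
  show "symp L1_rel"
    by (rule sympI) (auto simp: L1_rel_def)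
  show "transp L1_rel"
  proof (rule transpI)
    fix f g h
    assume fg: "L1_rel f g" and gh: "L1_rel g h"
    have "AE x in I01. f x = g x" "AE x in I01. g x = h x"
      using fg gh by (auto simp: L1_rel_def)
    then have "AE x in I01. f x = h x"
      by eventually_elim simp
    then show "L1_rel f h"
      using fg gh by (auto simp: L1_rel_def)
  qed
qed

quotient_type L1 = "real \<Rightarrow> real" / partial: L1_rel
  by (rule L1_rel_part_equivp)

instantiation L1 :: real_vector
begin

lift_definition zero_L1 :: L1 is "\<lambda>_. 0"
  by (simp add: L1_rel_def)

lift_definition plus_L1 :: "L1 \<Rightarrow> L1 \<Rightarrow> L1" is "\<lambda>f g x. f x + g x"
  unfolding L1_rel_def by auto

lift_definition minus_L1 :: "L1 \<Rightarrow> L1 \<Rightarrow> L1" is "\<lambda>f g x. f x - g x"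
  unfolding L1_rel_def by auto

lift_definition uminus_L1 :: "L1 \<Rightarrow> L1" is "\<lambda>f x. - f x"
  unfolding L1_rel_def by auto

lift_definition scaleR_L1 :: "real \<Rightarrow> L1 \<Rightarrow> L1" is "\<lambda>c f x. c * f x"
  unfolding L1_rel_def by auto

instance
proof
  fix a b c :: L1 and r s :: real
  show "a + b + c = a + (b + c)"
    by transfer (auto simp: L1_rel_def add.assoc)
  show "a + b = b + a"
    by transfer (auto simp: L1_rel_def add.commute)
  show "0 + a = a"
    by transfer (auto simp: L1_rel_def)
  show "- a + a = 0"
    by transfer (auto simp: L1_rel_def)
  show "a - b = a + - b"
    by transfer (auto simp: L1_rel_def)
  show "r *\<^sub>R (a + b) = r *\<^sub>R a + r *\<^sub>R b"
    by transfer (auto simp: L1_rel_def algebra_simps)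
  show "(r + s) *\<^sub>R a = r *\<^sub>R a + s *\<^sub>R a"
    by transfer (auto simp: L1_rel_def algebra_simps)
  show "r *\<^sub>R s *\<^sub>R a = (r * s) *\<^sub>R a"
    by transfer (auto simp: L1_rel_def algebra_simps)
  show "1 *\<^sub>R a = a"
    by transfer (auto simp: L1_rel_def)
qed

end

instantiation L1 :: real_normed_vector
begin

lift_definition norm_L1 :: "L1 \<Rightarrow> real" is "\<lambda>f. \<integral>x. \<bar>f x\<bar> \<partial>I01"
  unfolding L1_rel_def by (auto intro!: integral_cong_AE)

definition dist_L1 :: "L1 \<Rightarrow> L1 \<Rightarrow> real"
  where "dist_L1 f g = norm (f - g)"

definition sgn_L1 :: "L1 \<Rightarrow> L1"
  where "sgn_L1 f = f /\<^sub>R norm f"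

definition uniformity_L1 :: "(L1 \<times> L1) filter"
  where "uniformity_L1 = (INF e\<in>{0<..}. principal {(f, g). dist f g < e})"

definition open_L1 :: "L1 set \<Rightarrow> bool"
  where "open_L1 U \<longleftrightarrow> (\<forall>f\<in>U. \<forall>\<^sub>F (f', g) in uniformity. f' = f \<longrightarrow> g \<in> U)"

instance
proof
  fix a b :: L1 and r :: real and U :: "L1 set"
  show "dist a b = norm (a - b)"
    by (rule dist_L1_def)
  show "sgn a = a /\<^sub>R norm a"
    by (rule sgn_L1_def)
  show "uniformity = (INF e\<in>{0<..}. principal {(f :: L1, g). dist f g < e})"
    by (rule uniformity_L1_def)
  show "open U \<longleftrightarrow> (\<forall>f\<in>U. \<forall>\<^sub>F (f', g) in uniformity. f' = f \<longrightarrow> g \<in> U)"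
    by (rule open_L1_def)
  show "norm a = 0 \<longleftrightarrow> a = 0"
    by transfer (auto simp: L1_rel_def integral_nonneg_eq_0_iff_AE)
  show "norm (a + b) \<le> norm a + norm b"
  proof transfer
    fix f g
    assume "L1_rel f f" "L1_rel g g"
    then have f: "integrable I01 f" and g: "integrable I01 g"
      by (auto simp: L1_rel_def)
    have "(\<integral>x. \<bar>f x + g x\<bar> \<partial>I01) \<le> (\<integral>x. \<bar>f x\<bar> + \<bar>g x\<bar> \<partial>I01)"
      using f g by (intro integral_mono) auto
    also have "\<dots> = (\<integral>x. \<bar>f x\<bar> \<partial>I01) + (\<integral>x. \<bar>g x\<bar> \<partial>I01)"
      using f g by simp
    finally show "(\<integral>x. \<bar>f x + g x\<bar> \<partial>I01) \<le> (\<integral>x. \<bar>f x\<bar> \<partial>I01) + (\<integral>x. \<bar>g x\<bar> \<partial>I01)" .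
  qed
  show "norm (r *\<^sub>R a) = \<bar>r\<bar> * norm a"
    by transfer (simp add: abs_mult)
qed

end


section \<open>Magnitude\<close>

text \<open>
  A metric is an explicit function argument, because rescaling changes it while the points stay
  the same.  A real matrix indexed by a finite set is a binary function, of which only the
  values on that set matter.
\<close>

definition sim_matrix :: "('a \<Rightarrow> 'a \<Rightarrow> real) \<Rightarrow> 'a \<Rightarrow> 'a \<Rightarrow> real"
  where "sim_matrix d a b = exp (- d a b)"

definition matrix_inverse_on :: "'a set \<Rightarrow> ('a \<Rightarrow> 'a \<Rightarrow> real) \<Rightarrow> ('a \<Rightarrow> 'a \<Rightarrow> real) \<Rightarrow> bool"
  where "matrix_inverse_on A Z W \<longleftrightarrow>
    (\<forall>a\<in>A. \<forall>b\<in>A. (\<Sum>c\<in>A. Z a c * W c b) = of_bool (a = b) \<and>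
                 (\<Sum>c\<in>A. W a c * Z c b) = of_bool (a = b))"

lemma matrix_inverse_on_unique:
  assumes "finite A" "matrix_inverse_on A Z W" "matrix_inverse_on A Z W'" "a \<in> A" "b \<in> A"
  shows "W a b = W' a b"
proof -
  have "W a b = (\<Sum>c\<in>A. W a c * of_bool (c = b))"
    using assms by (simp add: of_bool_def if_distrib cong: if_cong)
  also have "\<dots> = (\<Sum>c\<in>A. W a c * (\<Sum>e\<in>A. Z c e * W' e b))"
    using assms by (intro sum.cong) (auto simp: matrix_inverse_on_def)
  also have "\<dots> = (\<Sum>e\<in>A. (\<Sum>c\<in>A. W a c * Z c e) * W' e b)"
    by (simp add: sum_distrib_left sum_distrib_right mult.assoc) (rule sum.swap)
  also have "\<dots> = (\<Sum>e\<in>A. of_bool (a = e) * W' e b)"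
    using assms by (intro sum.cong) (auto simp: matrix_inverse_on_def)
  also have "\<dots> = W' a b"
    using assms by (simp add: of_bool_def if_distrib[of "\<lambda>x. x * _"] cong: if_cong)
  finally show ?thesis .
qed

text \<open>By the lemma above, the choice of the inverse in the next definition is immaterial.\<close>

definition finite_magnitude :: "('a \<Rightarrow> 'a \<Rightarrow> real) \<Rightarrow> 'a set \<Rightarrow> real"
  where "finite_magnitude d A =
    (if \<exists>W. matrix_inverse_on A (sim_matrix d) W
     then let W = (SOME W. matrix_inverse_on A (sim_matrix d) W) in \<Sum>a\<in>A. \<Sum>b\<in>A. W a b
     else undefined)"

definition pos_def_matrix_on :: "'a set \<Rightarrow> ('a \<Rightarrow> 'a \<Rightarrow> real) \<Rightarrow> bool"
  where "pos_def_matrix_on A Z \<longleftrightarrow>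
    (\<forall>a\<in>A. \<forall>b\<in>A. Z a b = Z b a) \<and>
    (\<forall>v. (\<exists>a\<in>A. v a \<noteq> 0) \<longrightarrow> (\<Sum>a\<in>A. \<Sum>b\<in>A. v a * Z a b * v b) > 0)"

definition pos_def_space :: "('a \<Rightarrow> 'a \<Rightarrow> real) \<Rightarrow> 'a set \<Rightarrow> bool"
  where "pos_def_space d X \<longleftrightarrow>
    (\<forall>A. finite A \<and> A \<subseteq> X \<longrightarrow> pos_def_matrix_on A (sim_matrix d))"

definition magnitude :: "('a \<Rightarrow> 'a \<Rightarrow> real) \<Rightarrow> 'a set \<Rightarrow> ereal"
  where "magnitude d X =
    (if pos_def_space d X
     then SUP A\<in>{A. finite A \<and> A \<subseteq> X}. ereal (finite_magnitude d A)
     else undefined)"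

definition rescale :: "real \<Rightarrow> ('a \<Rightarrow> 'a \<Rightarrow> real) \<Rightarrow> 'a \<Rightarrow> 'a \<Rightarrow> real"
  where "rescale t d x y = t * d x y"

definition one_point_property :: "('a \<Rightarrow> 'a \<Rightarrow> real) \<Rightarrow> 'a set \<Rightarrow> bool"
  where "one_point_property d X \<longleftrightarrow> ((\<lambda>t. magnitude (rescale t d) X) \<longlongrightarrow> 1) (at_right 0)"

end

theory Submission
  imports Defs
begin

text \<open>
  A bounded subset \<open>A\<close> of a finite-dimensional subspace is dominated by one integrable \<open>g\<close>:
  \<open>\<bar>a\<bar> \<le> g\<close> a.e. for all \<open>a \<in> A\<close>.  Put \<open>G = \<integral>g\<close>.  For \<open>x, y \<in> [-r, r]\<close> one has
  \<open>2 (r - \<bar>x - y\<bar>) = \<integral>\<sigma>\<^sub>x(h) \<sigma>\<^sub>y(h) dh\<close> over \<open>[-r, r]\<close>, where \<open>\<sigma>\<^sub>x(h)\<close> is \<open>-1\<close> if \<open>h < x\<close> and \<open>1\<close>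
  otherwise.  Integrating with \<open>r = g(s)\<close>, multiplication by the kernel \<open>K = G - d\<close> preserves
  positive semidefiniteness, so all pointwise powers of \<open>K\<close> are positive semidefinite, and so is
  \<open>exp (t K) - 1\<close>.  Hence \<open>(\<Sum>v)\<^sup>2 \<le> exp (t G) * v\<^sup>T Z v\<close> for the similarity matrix \<open>Z\<close> of every
  finite subset of \<open>tA\<close>; taking for \<open>v\<close> the weighting, \<open>Z v = 1\<close>, yields
  \<open>1 \<le> \<bar>tA\<bar> \<le> exp (t G)\<close>.
\<close>

section \<open>Positive semidefinite kernels\<close>

definition psd_on :: "'a set \<Rightarrow> ('a \<Rightarrow> 'a \<Rightarrow> real) \<Rightarrow> bool"
  where "psd_on A K \<longleftrightarrow> (\<forall>v. 0 \<le> (\<Sum>a\<in>A. \<Sum>b\<in>A. v a * K a b * v b))"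

lemma psd_onD: "psd_on A K \<Longrightarrow> 0 \<le> (\<Sum>a\<in>A. \<Sum>b\<in>A. v a * K a b * v b)"
  by (simp add: psd_on_def)

lemma quadratic_form_one:
  fixes v :: "'a \<Rightarrow> real"
  shows "(\<Sum>a\<in>A. \<Sum>b\<in>A. v a * 1 * v b) = (\<Sum>a\<in>A. v a)\<^sup>2"
  by (simp add: power2_eq_square sum_product)

lemma psd_on_one: "psd_on A (\<lambda>_ _. 1)"
  unfolding psd_on_def quadratic_form_one by simp

text \<open>The product of the two signs is -1 exactly for \<open>h\<close> in
  \<open>{min x y..<max x y}\<close>, which the bounds place inside \<open>{-r..r}\<close>;
  elsewhere it is 1. So the integral is the length \<open>2 * r\<close> minus twice
  \<open>\<bar>x - y\<bar>\<close>.\<close>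

lemma cut_integral:
  fixes x y r :: real
  assumes "\<bar>x\<bar> \<le> r" "\<bar>y\<bar> \<le> r"
  shows "has_bochner_integral lborel
    (\<lambda>h. indicator {-r..r} h * ((1 - 2 * of_bool (h < x)) * (1 - 2 * of_bool (h < y))))
    (2 * (r - \<bar>x - y\<bar>))"
proof -
  have "has_bochner_integral lborel
      (\<lambda>h. indicator {-r..r} h - 2 * indicator {min x y..<max x y} h)
      (measure lborel {-r..r} - 2 * measure lborel {min x y..<max x y})"
    by (intro has_bochner_integral_diff has_bochner_integral_mult_right
        has_bochner_integral_real_indicator) (auto simp: emeasure_lborel_Icc_eq)
  moreover have "(\<lambda>h. indicator {-r..r} h - 2 * indicator {min x y..<max x y} h) =
    (\<lambda>h. indicator {-r..r} h * ((1 - 2 * of_bool (h < x)) * (1 - 2 * of_bool (h < y))) :: real)"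
    using assms by (intro ext) (auto simp: indicator_def min_def max_def)
  moreover have "measure lborel {-r..r} - 2 * measure lborel {min x y..<max x y} =
      2 * (r - \<bar>x - y\<bar>)"
    using assms by (auto simp: min_def max_def)
  ultimately show ?thesis
    by simp
qed

text \<open>By \<open>cut_integral\<close> the factor \<open>r - \<bar>x a - x b\<bar>\<close> is a
  mixture of rank-one sign kernels. For each fixed \<open>h\<close> the signs are absorbed into the
  vector \<open>v\<close>, which leaves a value of the form of \<open>L\<close>.\<close>

lemma psd_on_interval_mult:
  fixes x :: "'a \<Rightarrow> real"
  assumes L: "psd_on A L" and x: "\<And>a. a \<in> A \<Longrightarrow> \<bar>x a\<bar> \<le> r"
  shows "psd_on A (\<lambda>a b. (r - \<bar>x a - x b\<bar>) * L a b)"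
  unfolding psd_on_def
proof
  fix v :: "'a \<Rightarrow> real"
  define s where "s h a = (1 - 2 * of_bool (h < x a) :: real)" for h a
  have "has_bochner_integral lborel
      (\<lambda>h. \<Sum>a\<in>A. \<Sum>b\<in>A. (v a * L a b * v b) * (indicator {-r..r} h * (s h a * s h b)))
      (\<Sum>a\<in>A. \<Sum>b\<in>A. (v a * L a b * v b) * (2 * (r - \<bar>x a - x b\<bar>)))"
    unfolding s_def
    by (intro has_bochner_integral_sum has_bochner_integral_mult_right cut_integral x)
  moreover have "(\<Sum>a\<in>A. \<Sum>b\<in>A. (v a * L a b * v b) * (indicator {-r..r} h * (s h a * s h b))) =
      indicator {-r..r} h * (\<Sum>a\<in>A. \<Sum>b\<in>A. (v a * s h a) * L a b * (v b * s h b))" for h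
    by (simp add: sum_distrib_left ac_simps)
  ultimately have "has_bochner_integral lborel
      (\<lambda>h. indicator {-r..r} h * (\<Sum>a\<in>A. \<Sum>b\<in>A. (v a * s h a) * L a b * (v b * s h b)))
      (\<Sum>a\<in>A. \<Sum>b\<in>A. (v a * L a b * v b) * (2 * (r - \<bar>x a - x b\<bar>)))"
    by (simp only:)
  moreover have "0 \<le> indicator {-r..r} h *
      (\<Sum>a\<in>A. \<Sum>b\<in>A. (v a * s h a) * L a b * (v b * s h b))" for h
    by (intro mult_nonneg_nonneg psd_onD[OF L]) simp
  ultimately have "0 \<le> (\<Sum>a\<in>A. \<Sum>b\<in>A. (v a * L a b * v b) * (2 * (r - \<bar>x a - x b\<bar>)))"
    by (metis (no_types, lifting) Bochner_Integration.integral_nonneg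
        has_bochner_integral_integral_eq)
  also have "\<dots> = 2 * (\<Sum>a\<in>A. \<Sum>b\<in>A. v a * ((r - \<bar>x a - x b\<bar>) * L a b) * v b)"
    by (simp add: sum_distrib_left ac_simps)
  finally show "0 \<le> (\<Sum>a\<in>A. \<Sum>b\<in>A. v a * ((r - \<bar>x a - x b\<bar>) * L a b) * v b)"
    by simp
qed

lemma psd_on_integral_mult:
  fixes \<phi> :: "'a \<Rightarrow> 's \<Rightarrow> real"
  assumes "finite A" and L: "psd_on A L"
    and int: "\<And>a. a \<in> A \<Longrightarrow> integrable M (\<phi> a)" "integrable M g"
    and bound: "\<And>a. a \<in> A \<Longrightarrow> AE s in M. \<bar>\<phi> a s\<bar> \<le> g s"
  shows "psd_on A (\<lambda>a b. ((\<integral>s. g s \<partial>M) - (\<integral>s. \<bar>\<phi> a s - \<phi> b s\<bar> \<partial>M)) * L a b)"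
  unfolding psd_on_def
proof
  fix v :: "'a \<Rightarrow> real"
  \<comment> \<open>Finiteness of \<open>A\<close> merges the exceptional null sets, so that
    \<open>psd_on_interval_mult\<close> applies with \<open>r = g s\<close> at almost every
    \<open>s\<close>.\<close>
  have "AE s in M. \<forall>a\<in>A. \<bar>\<phi> a s\<bar> \<le> g s"
    using bound \<open>finite A\<close> by (simp add: AE_finite_all)
  then have "AE s in M. 0 \<le> (\<Sum>a\<in>A. \<Sum>b\<in>A. v a * ((g s - \<bar>\<phi> a s - \<phi> b s\<bar>) * L a b) * v b)"
    by eventually_elim (intro psd_onD psd_on_interval_mult L, auto)
  then have "0 \<le> (\<integral>s. (\<Sum>a\<in>A. \<Sum>b\<in>A. v a * ((g s - \<bar>\<phi> a s - \<phi> b s\<bar>) * L a b) * v b) \<partial>M)"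
    by (rule integral_nonneg_AE)
  also have "\<dots> = (\<Sum>a\<in>A. \<Sum>b\<in>A. v a *
      (((\<integral>s. g s \<partial>M) - (\<integral>s. \<bar>\<phi> a s - \<phi> b s\<bar> \<partial>M)) * L a b) * v b)"
    using int by (simp add: Bochner_Integration.integral_sum)
  finally show "0 \<le> \<dots>" .
qed

text \<open>Expanding the exponential entrywise separates \<open>t\<close> from the forms of the
  powers of \<open>K\<close>. The sign or vanishing of the sum can then be read off
  termwise.\<close>

lemma exp_quadratic_form_sums:
  fixes K :: "'a \<Rightarrow> 'a \<Rightarrow> real"
  shows "(\<lambda>n. (\<Sum>a\<in>A. \<Sum>b\<in>A. v a * K a b ^ n * v b) * (t ^ n / fact n)) sums
    (\<Sum>a\<in>A. \<Sum>b\<in>A. v a * exp (t * K a b) * v b)"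
proof -
  have "(\<lambda>n. \<Sum>a\<in>A. \<Sum>b\<in>A. v a * ((t * K a b) ^ n /\<^sub>R fact n) * v b) sums
    (\<Sum>a\<in>A. \<Sum>b\<in>A. v a * exp (t * K a b) * v b)"
    by (intro sums_sum sums_mult sums_mult2 exp_converges)
  then show ?thesis
    by (simp add: sum_distrib_left sum_distrib_right power_mult_distrib divide_inverse ac_simps)
qed

text \<open>All terms of the series are nonnegative, and the one for \<open>n = 0\<close> is the
  square on the left.\<close>

lemma exp_quadratic_form_ge:
  fixes K :: "'a \<Rightarrow> 'a \<Rightarrow> real"
  assumes psd: "\<And>n. psd_on A (\<lambda>a b. K a b ^ n)" and "0 \<le> t"
  shows "(\<Sum>a\<in>A. v a)\<^sup>2 \<le> (\<Sum>a\<in>A. \<Sum>b\<in>A. v a * exp (t * K a b) * v b)"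
proof -
  let ?f = "\<lambda>n. (\<Sum>a\<in>A. \<Sum>b\<in>A. v a * K a b ^ n * v b) * (t ^ n / fact n)"
  have sums: "?f sums (\<Sum>a\<in>A. \<Sum>b\<in>A. v a * exp (t * K a b) * v b)"
    by (rule exp_quadratic_form_sums)
  have "0 \<le> ?f n" for n
    using psd_onD[OF psd] \<open>0 \<le> t\<close> by (intro mult_nonneg_nonneg) auto
  then have "sum ?f {0} \<le> suminf ?f"
    by (intro sum_le_suminf sums_summable[OF sums]) auto
  then show ?thesis
    using quadratic_form_one[of v A] sums_unique[OF sums] by simp
qed

text \<open>
  If the quadratic form of \<open>exp (- d)\<close> vanishes at \<open>v\<close>, then so does every term of the power
  series, hence the form of \<open>exp (- s * d)\<close> vanishes for all \<open>s > 0\<close>; but as \<open>s\<close> tends to infinity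
  these matrices tend to the identity.
\<close>

lemma exp_quadratic_form_pos:
  fixes d :: "'a \<Rightarrow> 'a \<Rightarrow> real"
  assumes "finite A" and psd: "\<And>n. psd_on A (\<lambda>a b. (G - d a b) ^ n)" and t: "0 < t"
    and d0: "\<And>a. a \<in> A \<Longrightarrow> d a a = 0"
    and d_pos: "\<And>a b. a \<in> A \<Longrightarrow> b \<in> A \<Longrightarrow> a \<noteq> b \<Longrightarrow> 0 < d a b"
    and v: "a\<^sub>0 \<in> A" "v a\<^sub>0 \<noteq> 0"
  shows "0 < (\<Sum>a\<in>A. \<Sum>b\<in>A. v a * exp (t * (G - d a b)) * v b)"
proof (rule ccontr)
  let ?q = "\<lambda>n. \<Sum>a\<in>A. \<Sum>b\<in>A. v a * (G - d a b) ^ n * v b"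
  let ?Q = "\<lambda>t. \<Sum>a\<in>A. \<Sum>b\<in>A. v a * exp (t * (G - d a b)) * v b"
  have sums: "(\<lambda>n. ?q n * (t ^ n / fact n)) sums ?Q t" for t
    by (rule exp_quadratic_form_sums)
  have nonneg: "0 \<le> ?q n * (t ^ n / fact n)" for n
    using psd_onD[OF psd] t by (intro mult_nonneg_nonneg) auto
  assume "\<not> 0 < ?Q t"
  moreover have "0 \<le> ?Q t"
    using sums_le[OF nonneg sums_zero sums] by simp
  ultimately have "?Q t = 0"
    by linarith
  then have "(\<Sum>n. ?q n * (t ^ n / fact n)) = 0"
    using sums_unique[OF sums] by metis
  then have *: "?q n * (t ^ n / fact n) = 0" for n
    using suminf_eq_zero_iff[OF sums_summable[OF sums] nonneg] by blast
  have q0: "?q n = 0" for n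
    using *[of n] t by auto
  have Q0: "?Q s = 0" for s
    using sums_unique[OF sums[of s]] unfolding q0 by simp
  have "((\<lambda>s. \<Sum>a\<in>A. \<Sum>b\<in>A. v a * exp (- (s * d a b)) * v b) \<longlongrightarrow>
      (\<Sum>a\<in>A. \<Sum>b\<in>A. v a * of_bool (a = b) * v b)) at_top"
  proof (intro tendsto_sum tendsto_mult tendsto_const)
    fix a b assume ab: "a \<in> A" "b \<in> A"
    show "((\<lambda>s. exp (- (s * d a b))) \<longlongrightarrow> of_bool (a = b)) at_top"
    proof (cases "a = b")
      case False
      then have "filterlim (\<lambda>s. s * d a b) at_top at_top"
        using d_pos ab by (intro filterlim_at_top_mult_tendsto_pos[OF tendsto_const])
            (auto simp: filterlim_ident)
      then have "((\<lambda>s. exp (- (s * d a b))) \<longlongrightarrow> 0) at_top"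
        by (intro filterlim_compose[OF exp_at_bot]) (simp add: filterlim_uminus_at_bot)
      with False show ?thesis
        by simp
    qed (use d0 ab in simp)
  qed
  \<comment> \<open>Up to a scalar this is \<open>?Q s\<close>, so it is constantly 0, and so is its
    limit, the sum of the squares of \<open>v\<close>.\<close>
  moreover have "(\<Sum>a\<in>A. \<Sum>b\<in>A. v a * exp (- (s * d a b)) * v b) = exp (- (s * G)) * ?Q s" for s
    by (simp add: sum_distrib_left right_diff_distrib exp_diff exp_minus field_simps)
  ultimately have "(\<Sum>a\<in>A. \<Sum>b\<in>A. v a * of_bool (a = b) * v b) = 0"
    by (simp add: Q0 tendsto_const_iff)
  then have "(\<Sum>a\<in>A. (v a)\<^sup>2) = 0"
    using \<open>finite A\<close>
    by (simp add: of_bool_def if_distrib[of "\<lambda>x. _ * x * _"] power2_eq_square cong: if_cong)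
  then show False
    using v \<open>finite A\<close> by (simp add: sum_nonneg_eq_0_iff)
qed

section \<open>Inverses of positive definite matrices\<close>

text \<open>Extending a vector by zero from \<open>A\<close> to \<open>B\<close> keeps it nonzero
  and does not change the value of the form.\<close>

lemma pos_def_matrix_on_subset:
  assumes Z: "pos_def_matrix_on B Z" and "A \<subseteq> B" "finite B"
  shows "pos_def_matrix_on A Z"
  unfolding pos_def_matrix_on_def
proof (intro conjI allI impI)
  show "\<forall>a\<in>A. \<forall>b\<in>A. Z a b = Z b a"
    using Z \<open>A \<subseteq> B\<close> unfolding pos_def_matrix_on_def by blast
next
  fix v :: "'a \<Rightarrow> real"
  assume v: "\<exists>a\<in>A. v a \<noteq> 0"
  define u where "u a = (if a \<in> A then v a else 0)" for a
  have "0 < (\<Sum>a\<in>B. \<Sum>b\<in>B. u a * Z a b * u b)"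
  proof -
    have "\<exists>a\<in>B. u a \<noteq> 0"
      using v \<open>A \<subseteq> B\<close> by (auto simp: u_def)
    then show ?thesis
      using Z by (simp add: pos_def_matrix_on_def)
  qed
  also have "\<dots> = (\<Sum>a\<in>A. \<Sum>b\<in>B. u a * Z a b * u b)"
    using assms by (intro sum.mono_neutral_right) (auto simp: u_def)
  also have "\<dots> = (\<Sum>a\<in>A. \<Sum>b\<in>A. u a * Z a b * u b)"
    using assms by (intro sum.cong sum.mono_neutral_right) (auto simp: u_def)
  finally show "0 < (\<Sum>a\<in>A. \<Sum>b\<in>A. v a * Z a b * v b)"
    by (simp add: u_def)
qed

text \<open>Block elimination: the Schur complement \<open>S\<close> is a value of the quadratic form.\<close>

lemma pos_def_matrix_on_solve:
  assumes "finite A" "pos_def_matrix_on A Z"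
  shows "\<exists>x. \<forall>a\<in>A. (\<Sum>c\<in>A. Z a c * x c) = y a"
  using assms
proof (induction A arbitrary: y rule: finite_induct)
  case empty
  then show ?case by simp
next
  case (insert p A)
  have pd: "pos_def_matrix_on A Z"
    using pos_def_matrix_on_subset[OF insert.prems] insert.hyps by auto
  obtain u where u: "\<And>a. a \<in> A \<Longrightarrow> (\<Sum>c\<in>A. Z a c * u c) = y a"
    using insert.IH[OF pd, of y] by blast
  obtain g where g: "\<And>a. a \<in> A \<Longrightarrow> (\<Sum>c\<in>A. Z a c * g c) = Z a p"
    using insert.IH[OF pd, of "\<lambda>a. Z a p"] by blast
  define S where "S = Z p p - (\<Sum>c\<in>A. Z p c * g c)"
  \<comment> \<open>\<open>k\<close> is chosen so that \<open>Z k\<close> vanishes on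
    \<open>A\<close> and equals \<open>S\<close> at \<open>p\<close>. Since \<open>k p = 1\<close>,
    the form at \<open>k\<close> is \<open>S\<close>.\<close>
  define k where "k a = (if a = p then 1 else - g a)" for a
  have k_A: "(\<Sum>c\<in>A. f c * k c) = - (\<Sum>c\<in>A. f c * g c)" for f
    unfolding sum_negf[symmetric] using insert.hyps by (intro sum.cong) (auto simp: k_def)
  have rowA: "(\<Sum>c\<in>insert p A. Z a c * k c) = 0" if "a \<in> A" for a
    using insert.hyps that by (simp add: k_A g) (simp add: k_def)
  have rowp: "(\<Sum>c\<in>insert p A. Z p c * k c) = S"
    using insert.hyps by (simp add: k_A S_def) (simp add: k_def)
  have "0 < (\<Sum>a\<in>insert p A. \<Sum>b\<in>insert p A. k a * Z a b * k b)"
    using insert.prems unfolding pos_def_matrix_on_def by (auto simp: k_def)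
  also have "\<dots> = (\<Sum>a\<in>insert p A. k a * (\<Sum>b\<in>insert p A. Z a b * k b))"
    by (simp only: sum_distrib_left mult.assoc)
  also have "\<dots> = k p * S + (\<Sum>a\<in>A. k a * (\<Sum>b\<in>insert p A. Z a b * k b))"
    by (subst sum.insert) (use insert.hyps rowp in auto)
  also have "\<dots> = S"
    using rowA by (simp add: k_def)
  finally have S: "0 < S" .
  \<comment> \<open>The solution is \<open>u\<close>, extended by zero to \<open>p\<close>, plus
    \<open>s\<close> times \<open>k\<close>. The rows in \<open>A\<close> then hold for every
    \<open>s\<close>, and row \<open>p\<close> determines \<open>s\<close>.\<close>
  define s where "s = (y p - (\<Sum>c\<in>A. Z p c * u c)) / S"
  define x where "x a = (if a = p then s else u a - s * g a)" for a
  have x_A: "(\<Sum>c\<in>A. f c * x c) = (\<Sum>c\<in>A. f c * u c) - s * (\<Sum>c\<in>A. f c * g c)" for f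
    unfolding sum_distrib_left sum_subtractf[symmetric] using insert.hyps
    by (intro sum.cong) (auto simp: x_def algebra_simps)
  have "(\<Sum>c\<in>insert p A. Z a c * x c) = y a" if "a \<in> A" for a
    using insert.hyps that by (simp add: x_A u g) (simp add: x_def)
  moreover have "(\<Sum>c\<in>insert p A. Z p c * x c) = y p"
  proof -
    have "(\<Sum>c\<in>insert p A. Z p c * x c) = s * S + (\<Sum>c\<in>A. Z p c * u c)"
      using insert.hyps by (simp add: x_A S_def) (simp add: x_def algebra_simps)
    with S show ?thesis
      by (simp add: s_def)
  qed
  ultimately show ?case
    by (intro exI[of _ x]) blast
qed

text \<open>Solving for each unit vector gives the columns \<open>X b\<close> of a right inverse. It
  inherits symmetry from \<open>Z\<close>, hence is a left inverse too.\<close>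

lemma pos_def_matrix_on_invertible:
  assumes "finite A" and Z: "pos_def_matrix_on A Z"
  shows "\<exists>W. matrix_inverse_on A Z W"
proof -
  have "\<forall>b. \<exists>x. \<forall>a\<in>A. (\<Sum>c\<in>A. Z a c * x c) = of_bool (a = b)"
    by (intro allI pos_def_matrix_on_solve[OF assms])
  then obtain X where X: "\<And>a b. a \<in> A \<Longrightarrow> (\<Sum>c\<in>A. Z a c * X b c) = of_bool (a = b)"
    by metis
  have sym: "Z a b = Z b a" if "a \<in> A" "b \<in> A" for a b
    using Z that by (auto simp: pos_def_matrix_on_def)
  \<comment> \<open>Both entries equal the bilinear form of \<open>Z\<close> at \<open>X a\<close>
    and \<open>X b\<close>, evaluated by applying \<open>Z\<close> first to one vector, then to the
    other.\<close>
  have X_sym: "X b a = X a b" if "a \<in> A" "b \<in> A" for a b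
  proof -
    have "X a b = (\<Sum>e\<in>A. X a e * of_bool (e = b))"
      using that assms by (simp add: of_bool_def if_distrib cong: if_cong)
    also have "\<dots> = (\<Sum>e\<in>A. X a e * (\<Sum>c\<in>A. Z e c * X b c))"
      by (intro sum.cong) (simp_all add: X)
    also have "\<dots> = (\<Sum>e\<in>A. \<Sum>c\<in>A. X a e * Z e c * X b c)"
      by (simp add: sum_distrib_left mult.assoc)
    also have "\<dots> = (\<Sum>c\<in>A. \<Sum>e\<in>A. X a e * Z e c * X b c)"
      by (rule sum.swap)
    also have "\<dots> = (\<Sum>c\<in>A. (\<Sum>e\<in>A. Z c e * X a e) * X b c)"
      unfolding sum_distrib_right by (intro sum.cong) (simp_all add: sym mult.commute)
    also have "\<dots> = (\<Sum>c\<in>A. of_bool (c = a) * X b c)"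
      by (intro sum.cong) (simp_all add: X)
    also have "\<dots> = X b a"
      using that assms by (simp add: of_bool_def if_distrib[of "\<lambda>x. x * _"] cong: if_cong)
    finally show ?thesis by simp
  qed
  have "(\<Sum>c\<in>A. X c a * Z c b) = of_bool (a = b)" if "a \<in> A" "b \<in> A" for a b
  proof -
    have "(\<Sum>c\<in>A. X c a * Z c b) = (\<Sum>c\<in>A. Z b c * X a c)"
      using that by (intro sum.cong) (simp_all add: sym X_sym mult.commute)
    then show ?thesis
      using that by (auto simp: X)
  qed
  then have "matrix_inverse_on A Z (\<lambda>a b. X b a)"
    by (simp add: matrix_inverse_on_def X)
  then show ?thesis
    by (rule exI[of _ "\<lambda>a b. X b a"])
qed

text \<open>The weighting consists of the row sums of the inverse matrix.\<close>

lemma finite_magnitude_weighting: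
  assumes "finite A" "pos_def_matrix_on A (sim_matrix d)"
  obtains v where "\<And>a. a \<in> A \<Longrightarrow> (\<Sum>b\<in>A. sim_matrix d a b * v b) = 1"
    and "finite_magnitude d A = (\<Sum>a\<in>A. v a)"
proof -
  define W where "W = (SOME W. matrix_inverse_on A (sim_matrix d) W)"
  note ex = pos_def_matrix_on_invertible[OF assms]
  then have W: "matrix_inverse_on A (sim_matrix d) W"
    unfolding W_def by (rule someI_ex)
  show thesis
  proof
    fix a assume a: "a \<in> A"
    have "(\<Sum>b\<in>A. sim_matrix d a b * (\<Sum>c\<in>A. W b c)) =
        (\<Sum>c\<in>A. \<Sum>b\<in>A. sim_matrix d a b * W b c)"
      unfolding sum_distrib_left by (rule sum.swap)
    also have "\<dots> = (\<Sum>c\<in>A. of_bool (a = c))"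
      using W a by (intro sum.cong) (auto simp: matrix_inverse_on_def)
    also have "\<dots> = 1"
      using a assms by (simp add: of_bool_def)
    finally show "(\<Sum>b\<in>A. sim_matrix d a b * (\<Sum>c\<in>A. W b c)) = 1" .
  next
    show "finite_magnitude d A = (\<Sum>a\<in>A. \<Sum>c\<in>A. W a c)"
      using ex by (simp add: finite_magnitude_def W_def)
  qed
qed

text \<open>At the weighting the quadratic form equals the magnitude \<open>m\<close> itself, so
  \<open>C\<close> gives \<open>m * m \<le> C * m\<close>. As \<open>C\<close> is nonnegative,
  \<open>m > C\<close> would contradict this.\<close>

lemma finite_magnitude_le:
  assumes "finite A" and pd: "pos_def_matrix_on A (sim_matrix d)" and "0 \<le> C"
    and C: "\<And>v. (\<Sum>a\<in>A. v a)\<^sup>2 \<le> C * (\<Sum>a\<in>A. \<Sum>b\<in>A. v a * sim_matrix d a b * v b)"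
  shows "finite_magnitude d A \<le> C"
proof -
  obtain v where v: "\<And>a. a \<in> A \<Longrightarrow> (\<Sum>b\<in>A. sim_matrix d a b * v b) = 1"
    and mag: "finite_magnitude d A = (\<Sum>a\<in>A. v a)"
    using finite_magnitude_weighting[OF assms(1) pd] by blast
  have "(\<Sum>a\<in>A. \<Sum>b\<in>A. v a * sim_matrix d a b * v b) =
      (\<Sum>a\<in>A. v a * (\<Sum>b\<in>A. sim_matrix d a b * v b))"
    by (simp add: sum_distrib_left mult.assoc)
  also have "\<dots> = (\<Sum>a\<in>A. v a)"
    by (intro sum.cong) (simp_all add: v)
  finally have "(\<Sum>a\<in>A. v a)\<^sup>2 \<le> C * (\<Sum>a\<in>A. v a)"
    using C[of v] by simp
  then show ?thesis
    using \<open>0 \<le> C\<close> unfolding mag power2_eq_square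
    by (metis linorder_not_le mult_right_less_imp_less mult_strict_right_mono order.trans order_less_imp_le)
qed

lemma finite_magnitude_singleton:
  assumes "d a a = 0"
  shows "finite_magnitude d {a} = 1"
proof -
  have "pos_def_matrix_on {a} (sim_matrix d)"
    using assms by (auto simp: pos_def_matrix_on_def sim_matrix_def zero_less_mult_iff)
  then show ?thesis
    using assms finite_magnitude_weighting[of "{a}" d] by (fastforce simp: sim_matrix_def)
qed

section \<open>Kernels on L1\<close>

lemma integrable_rep_L1 [simp]: "integrable I01 (rep_L1 f)"
  using Quotient_rep_reflp[OF Quotient_L1, of f] by (simp add: L1_rel_def)

text \<open>\<open>rep_L1\<close> picks an arbitrary representative of a class, so it respects the
  vector space operations only almost everywhere. The next lemmas derive this from the present
  one.\<close>

lemma AE_rep_abs_L1: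
  assumes "integrable I01 f"
  shows "AE x in I01. rep_L1 (abs_L1 f) x = f x"
  using Quotient_rep_abs[OF Quotient_L1, of f] assms by (simp add: L1_rel_def)

lemma AE_rep_add:
  "AE x in I01. rep_L1 (f + g) x = rep_L1 f x + rep_L1 g x"
proof -
  have "f + g = abs_L1 (\<lambda>x. rep_L1 f x + rep_L1 g x)"
    using plus_L1.abs_eq[of "rep_L1 f" "rep_L1 g"] Quotient_rep_reflp[OF Quotient_L1]
    by (simp add: Quotient_abs_rep[OF Quotient_L1])
  then show ?thesis
    by (simp add: AE_rep_abs_L1)
qed

lemma AE_rep_diff:
  "AE x in I01. rep_L1 (f - g) x = rep_L1 f x - rep_L1 g x"
proof -
  have "f - g = abs_L1 (\<lambda>x. rep_L1 f x - rep_L1 g x)"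
    using minus_L1.abs_eq[of "rep_L1 f" "rep_L1 g"] Quotient_rep_reflp[OF Quotient_L1]
    by (simp add: Quotient_abs_rep[OF Quotient_L1])
  then show ?thesis
    by (simp add: AE_rep_abs_L1)
qed

lemma AE_rep_scaleR: "AE x in I01. rep_L1 (c *\<^sub>R f) x = c * rep_L1 f x"
proof -
  have "c *\<^sub>R f = abs_L1 (\<lambda>x. c * rep_L1 f x)"
    using scaleR_L1.abs_eq[of "rep_L1 f" c] Quotient_rep_reflp[OF Quotient_L1]
    by (simp add: Quotient_abs_rep[OF Quotient_L1])
  then show ?thesis
    by (simp add: AE_rep_abs_L1)
qed

lemma AE_rep_linear_combination:
  assumes "finite B"
  shows "AE x in I01. rep_L1 (\<Sum>b\<in>B. u b *\<^sub>R b) x = (\<Sum>b\<in>B. u b * rep_L1 b x)"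
  using assms
proof induction
  case empty
  show ?case
    using AE_rep_scaleR[of 0 0] by simp
next
  case (insert b B)
  show ?case
    using insert.IH AE_rep_scaleR[of "u b" b] AE_rep_add[of "u b *\<^sub>R b" "\<Sum>b\<in>B. u b *\<^sub>R b"]
    by eventually_elim (use insert.hyps in simp)
qed

lemma dist_L1_eq: "dist f g = (\<integral>x. \<bar>rep_L1 f x - rep_L1 g x\<bar> \<partial>I01)"
proof -
  have "norm (f - g) = (\<integral>x. \<bar>rep_L1 (f - g) x\<bar> \<partial>I01)"
    using norm_L1.abs_eq[of "rep_L1 (f - g)"] Quotient_rep_reflp[OF Quotient_L1]
    by (simp add: Quotient_abs_rep[OF Quotient_L1])
  also have "\<dots> = (\<integral>x. \<bar>rep_L1 f x - rep_L1 g x\<bar> \<partial>I01)"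
    using AE_rep_diff[of f g] by (intro integral_cong_AE)
      (auto intro!: borel_measurable_abs borel_measurable_diff borel_measurable_integrable)
  finally show ?thesis
    by (simp add: dist_norm)
qed

definition L1_dominated :: "(real \<Rightarrow> real) \<Rightarrow> L1 set \<Rightarrow> bool"
  where "L1_dominated g A \<longleftrightarrow>
    integrable I01 g \<and> (\<forall>a\<in>A. AE x in I01. \<bar>rep_L1 a x\<bar> \<le> g x)"

lemma psd_on_dist_power:
  assumes "L1_dominated g A" "finite A"
  shows "psd_on A (\<lambda>a b. ((\<integral>x. g x \<partial>I01) - dist a b) ^ n)"
proof (induction n)
  case 0
  show ?case
    by (simp add: psd_on_one)
next
  case (Suc n)
  show ?case
    using psd_on_integral_mult[OF \<open>finite A\<close> Suc, of I01 rep_L1 g] assms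
    by (simp add: L1_dominated_def dist_L1_eq)
qed

lemma sim_matrix_rescale:
  "sim_matrix (rescale t d) a b = exp (- (t * G)) * exp (t * (G - d a b))"
  by (simp add: sim_matrix_def rescale_def exp_add[symmetric] right_diff_distrib)

lemma sim_quadratic_form_rescale:
  "(\<Sum>a\<in>A. \<Sum>b\<in>A. v a * sim_matrix (rescale t d) a b * v b) =
    exp (- (t * G)) * (\<Sum>a\<in>A. \<Sum>b\<in>A. v a * exp (t * (G - d a b)) * v b)"
  by (simp add: sim_matrix_rescale[of t d _ _ G] sum_distrib_left mult.assoc mult.left_commute)

lemma pos_def_space_L1:
  assumes dom: "L1_dominated g A" and "0 < t"
  shows "pos_def_space (rescale t dist) A"
  unfolding pos_def_space_def pos_def_matrix_on_def
proof (intro allI impI conjI ballI)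
  fix F and v :: "L1 \<Rightarrow> real"
  assume F: "finite F \<and> F \<subseteq> A" and v: "\<exists>a\<in>F. v a \<noteq> 0"
  have "L1_dominated g F"
    using dom F by (auto simp: L1_dominated_def)
  then have "psd_on F (\<lambda>a b. ((\<integral>x. g x \<partial>I01) - dist a b) ^ n)" for n
    using F by (intro psd_on_dist_power) auto
  then have "0 < (\<Sum>a\<in>F. \<Sum>b\<in>F. v a * exp (t * ((\<integral>x. g x \<partial>I01) - dist a b)) * v b)"
    using F v \<open>0 < t\<close> by (auto intro: exp_quadratic_form_pos)
  then show "0 < (\<Sum>a\<in>F. \<Sum>b\<in>F. v a * sim_matrix (rescale t dist) a b * v b)"
    by (simp add: sim_quadratic_form_rescale[where G = "\<integral>x. g x \<partial>I01"])
qed (simp add: sim_matrix_def rescale_def dist_commute)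

lemma magnitude_L1_le:
  assumes dom: "L1_dominated g A" and "0 < t"
  shows "magnitude (rescale t dist) A \<le> ereal (exp (t * (\<integral>x. g x \<partial>I01)))"
proof -
  let ?G = "\<integral>x. g x \<partial>I01"
  have pd: "pos_def_space (rescale t dist) A"
    using assms by (rule pos_def_space_L1)
  have "finite_magnitude (rescale t dist) F \<le> exp (t * ?G)" if F: "finite F" "F \<subseteq> A" for F
  proof (rule finite_magnitude_le)
    show "pos_def_matrix_on F (sim_matrix (rescale t dist))"
      using pd F by (auto simp: pos_def_space_def)
    fix v :: "L1 \<Rightarrow> real"
    have "L1_dominated g F"
      using dom F by (auto simp: L1_dominated_def)
    then have "(\<Sum>a\<in>F. v a)\<^sup>2 \<le> (\<Sum>a\<in>F. \<Sum>b\<in>F. v a * exp (t * (?G - dist a b)) * v b)"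
      using F \<open>0 < t\<close> by (intro exp_quadratic_form_ge psd_on_dist_power) auto
    also have "\<dots> = exp (t * ?G) *
        (\<Sum>a\<in>F. \<Sum>b\<in>F. v a * sim_matrix (rescale t dist) a b * v b)"
      by (simp add: sim_quadratic_form_rescale[where G = ?G] exp_minus)
    finally show "(\<Sum>a\<in>F. v a)\<^sup>2 \<le>
        exp (t * ?G) * (\<Sum>a\<in>F. \<Sum>b\<in>F. v a * sim_matrix (rescale t dist) a b * v b)" .
  qed (use F in auto)
  then show ?thesis
    using pd by (auto simp: magnitude_def intro!: SUP_least)
qed

lemma magnitude_ge_1:
  assumes "pos_def_space d A" "a \<in> A" "d a a = 0"
  shows "1 \<le> magnitude d A"
proof -
  have "ereal (finite_magnitude d {a}) \<le> magnitude d A"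
    using assms by (auto simp: magnitude_def intro!: SUP_upper)
  then show ?thesis
    using finite_magnitude_singleton[of d a] assms by (simp add: one_ereal_def)
qed

section \<open>Finite-dimensional subspaces\<close>

lemma independent_coefficients_bounded:
  fixes B :: "'a::real_normed_vector set"
  assumes "finite B" "independent B"
  obtains C where "\<And>u b. b \<in> B \<Longrightarrow> \<bar>u b\<bar> \<le> C * norm (\<Sum>b\<in>B. u b *\<^sub>R b)"
proof (cases "B = {}")
  case True
  then show ?thesis
    using that by auto
next
  case False
  define K where "K = Pi\<^sub>E UNIV (\<lambda>b. if b \<in> B then {-1..1::real} else {0})"
  define S where "S = K \<inter> {c. (\<Sum>b\<in>B. \<bar>c b\<bar>) = 1}"
  have "compactin (product_topology (\<lambda>_. euclidean) UNIV) K"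
    unfolding K_def compactin_PiE by auto
  then have "compact K"
    by (simp add: euclidean_product_topology)
  moreover have "closed {c :: 'a \<Rightarrow> real. (\<Sum>b\<in>B. \<bar>c b\<bar>) = 1}"
    by (intro closed_Collect_eq continuous_intros continuous_on_product_coordinates)
  ultimately have S: "compact S"
    unfolding S_def by (rule compact_Int_closed)
  have S_I: "(\<lambda>b. if b \<in> B then c b else 0) \<in> S" if "(\<Sum>b\<in>B. \<bar>c b\<bar>) = 1" for c
  proof -
    have "\<bar>c b\<bar> \<le> 1" if "b \<in> B" for b
      using member_le_sum[of b B "\<lambda>b. \<bar>c b\<bar>"] that \<open>finite B\<close> \<open>(\<Sum>b\<in>B. \<bar>c b\<bar>) = 1\<close> by simp
    then show ?thesis
      using that by (auto simp: S_def K_def abs_le_iff minus_le_iff)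
  qed
  obtain b\<^sub>0 where "b\<^sub>0 \<in> B"
    using False by blast
  then have "(\<Sum>b\<in>B. \<bar>of_bool (b = b\<^sub>0) :: real\<bar>) = 1"
    using \<open>finite B\<close> by (simp add: of_bool_def if_distrib cong: if_cong)
  from S_I[OF this] have "S \<noteq> {}"
    by blast
  moreover have "continuous_on S (\<lambda>c. norm (\<Sum>b\<in>B. c b *\<^sub>R b))"
    by (intro continuous_intros continuous_on_subset[OF continuous_on_product_coordinates]) auto
  ultimately obtain m where m: "m \<in> S"
    and le: "\<And>c. c \<in> S \<Longrightarrow> norm (\<Sum>b\<in>B. m b *\<^sub>R b) \<le> norm (\<Sum>b\<in>B. c b *\<^sub>R b)"
    using continuous_attains_inf[OF S] by blast
  define \<delta> where "\<delta> = norm (\<Sum>b\<in>B. m b *\<^sub>R b)"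
  have "\<exists>b\<in>B. m b \<noteq> 0"
    using m by (rule contrapos_pp) (simp add: S_def)
  then have "0 < \<delta>"
    using assms dependent_finite[of B] by (auto simp: \<delta>_def)
  have "\<bar>u b\<bar> \<le> (1 / \<delta>) * norm (\<Sum>b\<in>B. u b *\<^sub>R b)" if "b \<in> B" for u b
  proof -
    define N where "N = (\<Sum>b\<in>B. \<bar>u b\<bar>)"
    have uN: "\<bar>u b\<bar> \<le> N"
      unfolding N_def using member_le_sum[of b B "\<lambda>b. \<bar>u b\<bar>"] that \<open>finite B\<close> by simp
    have "\<delta> * N \<le> norm (\<Sum>b\<in>B. u b *\<^sub>R b)"
    proof (cases "N = 0")
      case False
      then have "0 < N"
        using uN by linarith
      then have "(\<Sum>b\<in>B. \<bar>u b / N\<bar>) = 1"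
        by (simp add: sum_divide_distrib[symmetric] N_def[symmetric])
      from le[OF S_I[OF this]] have "\<delta> \<le> norm (\<Sum>b\<in>B. (u b / N) *\<^sub>R b)"
        by (simp add: \<delta>_def)
      also have "(\<Sum>b\<in>B. (u b / N) *\<^sub>R b) = (1 / N) *\<^sub>R (\<Sum>b\<in>B. u b *\<^sub>R b)"
        by (simp add: scaleR_sum_right)
      finally show ?thesis
        using \<open>0 < N\<close> by (simp add: field_simps)
    qed simp
    moreover have "\<delta> * \<bar>u b\<bar> \<le> \<delta> * N"
      using uN \<open>0 < \<delta>\<close> by simp
    ultimately have "\<delta> * \<bar>u b\<bar> \<le> norm (\<Sum>b\<in>B. u b *\<^sub>R b)"
      by linarith
    then show ?thesis
      using \<open>0 < \<delta>\<close> by (simp add: field_simps)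
  qed
  then show ?thesis
    by (rule that)
qed

lemma bounded_finite_dim_L1_dominated:
  fixes A :: "L1 set"
  assumes "finite B" "A \<subseteq> span B" "bounded A"
  obtains g where "L1_dominated g A"
proof -
  obtain D where D: "D \<subseteq> B" "independent D" "B \<subseteq> span D"
    using maximal_independent_subset[of B] by blast
  then have "finite D"
    using \<open>finite B\<close> finite_subset by blast
  have "A \<subseteq> span D"
    using D(3) assms(2) span_minimal[OF _ subspace_span] by blast
  obtain C where C: "\<And>u b. b \<in> D \<Longrightarrow> \<bar>u b\<bar> \<le> C * norm (\<Sum>b\<in>D. u b *\<^sub>R b)"
    using independent_coefficients_bounded[OF \<open>finite D\<close> D(2)] by blast
  obtain R where R: "\<And>a. a \<in> A \<Longrightarrow> norm a \<le> R"
    using \<open>bounded A\<close> by (auto simp: bounded_iff)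
  define g where "g x = (\<Sum>b\<in>D. (\<bar>C\<bar> * R) * \<bar>rep_L1 b x\<bar>)" for x
  have "AE x in I01. \<bar>rep_L1 a x\<bar> \<le> g x" if "a \<in> A" for a
  proof -
    obtain u where u: "a = (\<Sum>b\<in>D. u b *\<^sub>R b)"
      using \<open>A \<subseteq> span D\<close> \<open>a \<in> A\<close> unfolding span_finite[OF \<open>finite D\<close>] by blast
    have uC: "\<bar>u b\<bar> \<le> \<bar>C\<bar> * R" if "b \<in> D" for b
    proof -
      have "\<bar>u b\<bar> \<le> C * norm a"
        using C[OF that, of u] by (simp add: u)
      also have "\<dots> \<le> \<bar>C\<bar> * R"
        using R[OF \<open>a \<in> A\<close>] by (intro mult_mono) auto
      finally show ?thesis .
    qed
    have "AE x in I01. rep_L1 a x = (\<Sum>b\<in>D. u b * rep_L1 b x)"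
      unfolding u using \<open>finite D\<close> by (rule AE_rep_linear_combination)
    then show ?thesis
    proof eventually_elim
      case (elim x)
      have "\<bar>rep_L1 a x\<bar> \<le> (\<Sum>b\<in>D. \<bar>u b * rep_L1 b x\<bar>)"
        unfolding elim by (rule sum_abs)
      also have "\<dots> \<le> g x"
        unfolding g_def abs_mult by (intro sum_mono mult_right_mono uC) auto
      finally show ?case .
    qed
  qed
  moreover have "integrable I01 g"
    unfolding g_def by (intro Bochner_Integration.integrable_sum integrable_mult_right
        integrable_abs integrable_rep_L1)
  ultimately show ?thesis
    by (intro that[of g]) (simp add: L1_dominated_def)
qed

theorem theorem3p1:
  fixes A V :: "L1 set"
  assumes "subspace V"
    and "\<exists>B. finite B \<and> span B = V"
    and "A \<subseteq> V"
    and "compact A"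
    and "A \<noteq> {}"
  shows "magnitude dist A < \<infinity> \<and> one_point_property dist A"
proof -
  obtain B where "finite B" "A \<subseteq> span B"
    using assms by blast
  then obtain g where dom: "L1_dominated g A"
    using bounded_finite_dim_L1_dominated compact_imp_bounded[OF \<open>compact A\<close>] by blast
  let ?G = "\<integral>x. g x \<partial>I01"
  obtain a where "a \<in> A"
    using \<open>A \<noteq> {}\<close> by blast
  have "rescale 1 dist = (dist :: L1 \<Rightarrow> L1 \<Rightarrow> real)"
    by (intro ext) (simp add: rescale_def)
  then have "magnitude dist A \<le> ereal (exp ?G)"
    using magnitude_L1_le[OF dom, of 1] by simp
  then have "magnitude dist A < \<infinity>"
    by (rule order.strict_trans1) simp
  moreover have "((\<lambda>t. magnitude (rescale t dist) A) \<longlongrightarrow> 1) (at_right 0)"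
  proof (rule tendsto_sandwich)
    show "\<forall>\<^sub>F t in at_right 0. 1 \<le> magnitude (rescale t dist) A"
      using eventually_at_right_less[of "0 :: real"]
    proof eventually_elim
      case (elim t)
      show ?case
        using pos_def_space_L1[OF dom elim] \<open>a \<in> A\<close>
        by (rule magnitude_ge_1) (simp add: rescale_def)
    qed
    show "\<forall>\<^sub>F t in at_right 0. magnitude (rescale t dist) A \<le> ereal (exp (t * ?G))"
      using eventually_at_right_less[of "0 :: real"]
      by eventually_elim (rule magnitude_L1_le[OF dom])
    have "((\<lambda>t. exp (t * ?G)) \<longlongrightarrow> exp (0 * ?G)) (at_right 0)"
      by (intro tendsto_intros)
    then show "((\<lambda>t. ereal (exp (t * ?G))) \<longlongrightarrow> 1) (at_right 0)"
      by (simp add: one_ereal_def)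
  qed simp
  ultimately show ?thesis
    by (simp add: one_point_property_def)
qed

end
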